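(* Let $\mathbb{X}$ be a quasi-normed space, let $\mathcal{G}=\{g_n\}_{n\in\mathbb{N}}\subseteq\mathbb{X}$ be arbitrary, and let $P\in\mathbb{R}[X]$ be a polynomial. For $n\in\mathbb{N}$ define $$\mathcal{A}_n:=\Sigma_n(\mathcal{G},P):=\bigcup_{\substack{I_0\subseteq\{k\in\mathbb{N}:k\le P(n)\}\\ \#I_0\le n}}\operatorname{span}\{g_k:k\in I_0\},$$ with the convention $\operatorname{span}\emptyset=\{0\}$. Then the family $(\mathcal{A}_n)_{n\in\mathbb{N}}$ is of controlled complexity in $\mathbb{X}$.
   Context: A quasi-norm on a real or complex vector space is a definite, absolutely homogeneous map $\|\cdot\|$ to $[0,\infty)$ with $\|x+y\|\le k(\|x\|+\|y\|)$ for some constant $k\ge1$; the quasi-metric is $d(x,y)=\|x-y\|$ and $B(x,R)=\{y:\|x-y\|\le R\}$. For $\emptyset\ne S\subseteq\mathbb{X}$, $\mathcal{N}(S,\varepsilon)$ is the least $n\in\mathbb{N}$ such that $S$ is covered by $n$ closed balls of radius $\varepsilon$ with centers in $S$ ($\infty$ if there is none); $\mathcal{N}(\emptyset,\varepsilon)=0$. A family $(\mathcal{A}_n)_{n\in\mathbb{N}}$ of sets $\emptyset\ne\mathcal{A}_n\subseteq\mathbb{X}$ is of controlled complexity in $\mathbb{X}$ if for every $\alpha>0$, $x\in\mathbb{X}$ and $R>0$ there exist $n_0\in\mathbb{N}$ and a function $\eta:\mathbb{N}\to[0,\infty)$ such that $\sup_{n\in\mathbb{N}}\frac{\eta(n)}{n^{1+\delta}}<\infty$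 for every $\delta>0$, and $\mathcal{N}\big(B(x,R)\cap\mathcal{A}_n,\,n^{-\alpha}\big)\le\exp(\eta(n))$ for all $n\ge n_0$. *)

theory Defs
  imports "HOL-Analysis.Analysis" "HOL-Computational_Algebra.Polynomial"
begin

text \<open>
  A real or complex quasi-normed space. The sort of the scalar field \<open>'k\<close> contains \<^typ>\<open>real\<close> and
  \<^typ>\<open>complex\<close> with their absolute values and, by the Gelfand--Mazur theorem, nothing else up to
  isometric isomorphism.
\<close>

locale quasi_normed_space = vector_space smul
  for smul :: "'k::{real_normed_field, euclidean_space} \<Rightarrow> 'v::ab_group_add \<Rightarrow> 'v" +
  fixes qnorm :: "'v \<Rightarrow> real"
  assumes qnorm_nonneg: "0 \<le> qnorm x"
    and qnorm_eq_0_iff: "qnorm x = 0 \<longleftrightarrow> x = 0"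
    and qnorm_scale: "qnorm (smul a x) = norm a * qnorm x"
    and quasi_triangle: "\<exists>k\<ge>1. \<forall>x y. qnorm (x + y) \<le> k * (qnorm x + qnorm y)"

definition qcball :: "('v::ab_group_add \<Rightarrow> real) \<Rightarrow> 'v \<Rightarrow> real \<Rightarrow> 'v set" where
  "qcball qnorm x R = {y. qnorm (x - y) \<le> R}"

text \<open>The infimum in \<^typ>\<open>enat\<close> of the empty set is \<open>\<infinity>\<close>; otherwise it is attained.\<close>

definition covering_number :: "('v::ab_group_add \<Rightarrow> real) \<Rightarrow> 'v set \<Rightarrow> real \<Rightarrow> enat" where
  "covering_number qnorm S \<epsilon> =
    (if S = {} then 0
     else Inf {enat n | n. \<exists>C \<subseteq> S. finite C \<and> card C = n \<and> S \<subseteq> (\<Union>c\<in>C. qcball qnorm c \<epsilon>)})"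

text \<open>
  Here and in \<open>Sigma_poly\<close> below, \<open>\<nat> = {1, 2, \<dots>}\<close>, as the expressions \<open>n\<^sup>-\<^sup>\<alpha>\<close> and
  \<open>\<eta>(n) / n\<^sup>1\<^sup>+\<^sup>\<delta>\<close> require; values of sequences at \<open>0\<close> are irrelevant.
\<close>

definition controlled_complexity ::
  "('v::ab_group_add \<Rightarrow> real) \<Rightarrow> (nat \<Rightarrow> 'v set) \<Rightarrow> bool" where
  "controlled_complexity qnorm A \<longleftrightarrow>
    (\<forall>n\<ge>1. A n \<noteq> {}) \<and>
    (\<forall>\<alpha>>0. \<forall>x. \<forall>R>0. \<exists>n\<^sub>0\<ge>1. \<exists>\<eta> :: nat \<Rightarrow> real.
       (\<forall>n\<ge>1. 0 \<le> \<eta> n) \<and>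
       (\<forall>\<delta>>0. bdd_above ((\<lambda>n. \<eta> n / real n powr (1 + \<delta>)) ` {1..})) \<and>
       (\<forall>n\<ge>n\<^sub>0. ereal_of_enat (covering_number qnorm (qcball qnorm x R \<inter> A n) (real n powr - \<alpha>))
                  \<le> ereal (exp (\<eta> n))))"

definition Sigma_poly ::
  "('k::field \<Rightarrow> 'v::ab_group_add \<Rightarrow> 'v) \<Rightarrow> (nat \<Rightarrow> 'v) \<Rightarrow> real poly \<Rightarrow> nat \<Rightarrow> 'v set" where
  "Sigma_poly smul g P n =
    (\<Union>I \<in> {I. I \<subseteq> {k. 1 \<le> k \<and> real k \<le> poly P (real n)} \<and> card I \<le> n}.
       module.span smul (g ` I))"

end

theory Submission imports Defs begin

text \<open>
  The balls of an \<open>n\<close>-dimensional subspace are covered without volumes, since a quasi-norm need not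
  be measurable. Riesz' lemma gives a basis in which the top coefficient of every partial
  combination is controlled by the quasi-norm of that combination. Rounding the coefficients of a
  point one after the other from the top, to within \<open>\<delta>\<close>, leaves a number of choices for each of
  them that is polynomial in \<open>1/\<delta>\<close>. Adding up \<open>n\<close> errors in a balanced binary tree costs only a
  power of \<open>n\<close>, so radius \<open>n\<^sup>-\<^sup>\<alpha>\<close> is reached with a power of \<open>n\<close> choices per coefficient,
  that is with \<open>exp (O(n ln n))\<close> pieces. The number of index sets is of the same order.
\<close>

section \<open>Covers by sets of small diameter\<close>

text \<open>Pieces without centres: since \<open>covering_number\<close> wants its centres inside
  the covered set, it is not monotone in that set. This notion is inherited by subsets and adds up
  over unions.\<close>

definition diam_cover :: "('v::ab_group_add \<Rightarrow> real) \<Rightarrow> 'v set \<Rightarrow> nat \<Rightarrow> real \<Rightarrow> bool" where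
  "diam_cover qnorm S N \<epsilon> \<longleftrightarrow>
    (\<exists>F. finite F \<and> card F \<le> N \<and> S \<subseteq> \<Union>F \<and> (\<forall>T\<in>F. \<forall>x\<in>T. \<forall>y\<in>T. qnorm (x - y) \<le> \<epsilon>))"

lemma diam_cover_mono:
  "diam_cover qnorm S N \<epsilon> \<Longrightarrow> S' \<subseteq> S \<Longrightarrow> N \<le> N' \<Longrightarrow> diam_cover qnorm S' N' \<epsilon>"
  unfolding diam_cover_def by (meson order_trans)

lemma diam_cover_UN:
  assumes "finite J" and "\<And>j. j \<in> J \<Longrightarrow> diam_cover qnorm (S j) N \<epsilon>"
  shows "diam_cover qnorm (\<Union>j\<in>J. S j) (card J * N) \<epsilon>"
proof -
  obtain F where F: "\<And>j. j \<in> J \<Longrightarrow> finite (F j) \<and> card (F j) \<le> N \<and> S j \<subseteq> \<Union>(F j) \<and>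
      (\<forall>T\<in>F j. \<forall>x\<in>T. \<forall>y\<in>T. qnorm (x - y) \<le> \<epsilon>)"
    using assms(2) unfolding diam_cover_def by metis
  have "card (\<Union>(F ` J)) \<le> (\<Sum>j\<in>J. card (F j))"
    using assms(1) by (rule card_UN_le)
  also have "\<dots> \<le> card J * N"
    using sum_bounded_above[of J "\<lambda>j. card (F j)" N] F by simp
  finally have "card (\<Union>(F ` J)) \<le> card J * N" .
  moreover have "finite (\<Union>(F ` J))" using assms(1) F by (intro finite_UN_I) auto
  moreover have "(\<Union>j\<in>J. S j) \<subseteq> \<Union>(\<Union>(F ` J))"
  proof
    fix x assume "x \<in> (\<Union>j\<in>J. S j)"
    then obtain j where "j \<in> J" "x \<in> S j" by (elim UN_E)
    moreover from this F have "x \<in> \<Union>(F j)" by (meson subsetD)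
    ultimately show "x \<in> \<Union>(\<Union>(F ` J))" by (meson UN_I UnionE UnionI)
  qed
  moreover have "\<forall>T\<in>\<Union>(F ` J). \<forall>x\<in>T. \<forall>y\<in>T. qnorm (x - y) \<le> \<epsilon>" using F by (meson UN_E)
  ultimately show ?thesis unfolding diam_cover_def by (intro exI[of _ "\<Union>(F ` J)"] conjI)
qed

text \<open>Any point of S in a piece that meets S can serve as the centre for that piece. As the
  diameter is bounded by \<epsilon>, the radius does not grow.\<close>

lemma covering_number_le:
  assumes "diam_cover qnorm S N \<epsilon>"
  shows "covering_number qnorm S \<epsilon> \<le> enat N"
proof (cases "S = {}")
  case True
  then show ?thesis by (simp add: covering_number_def)
next
  case False
  obtain F where F: "finite F" "card F \<le> N" "S \<subseteq> \<Union>F"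
      "\<forall>T\<in>F. \<forall>x\<in>T. \<forall>y\<in>T. qnorm (x - y) \<le> \<epsilon>"
    using assms unfolding diam_cover_def by metis
  let ?F = "{T \<in> F. T \<inter> S \<noteq> {}}"
  define c where "c T = (SOME x. x \<in> T \<inter> S)" for T
  have c: "c T \<in> T \<inter> S" if "T \<in> ?F" for T
  proof -
    have "\<exists>x. x \<in> T \<inter> S" using that by blast
    then show ?thesis unfolding c_def by (rule someI_ex)
  qed
  have "c ` ?F \<subseteq> S" using c by blast
  moreover have "finite (c ` ?F)" using F(1) by simp
  moreover have "S \<subseteq> (\<Union>y\<in>c ` ?F. qcball qnorm y \<epsilon>)"
  proof
    fix x assume "x \<in> S"
    then obtain T where "T \<in> F" "x \<in> T" using F(3) by blast
    with \<open>x \<in> S\<close> have T: "T \<in> ?F" by blast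
    then have "qnorm (c T - x) \<le> \<epsilon>" using F(4) c[OF T] \<open>x \<in> T\<close> by blast
    with T show "x \<in> (\<Union>y\<in>c ` ?F. qcball qnorm y \<epsilon>)"
      unfolding qcball_def by blast
  qed
  ultimately have "covering_number qnorm S \<epsilon> \<le> enat (card (c ` ?F))"
    unfolding covering_number_def if_not_P[OF False] by (intro Inf_lower) blast
  also have "card (c ` ?F) \<le> card ?F" using F(1) by (intro card_image_le) simp
  also have "\<dots> \<le> card F" using F(1) by (intro card_mono) auto
  finally show ?thesis using F(2) by (meson enat_ord_simps(1) order_trans)
qed

section \<open>Covers of scalar balls and growth of polynomials\<close>

text \<open>By compactness finitely many balls of radius 1/2 cover the unit ball; translating,
  scaling and iterating multiplies their number once per halving. The same \<open>N\<close> serves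
  all centres, radii and depths, so the number of pieces is polynomial in the ratio of the
  radii.\<close>

lemma cball_halving_cover:
  obtains N :: nat where
    "\<And>(c :: 'k::euclidean_space) r j. r > 0 \<Longrightarrow>
      \<exists>C. finite C \<and> card C \<le> N ^ j \<and> cball c r \<subseteq> (\<Union>y\<in>C. cball y (r / 2 ^ j))"
proof -
  have "compact (cball (0::'k) 1)" by simp
  then obtain K where K: "finite K" "cball (0::'k) 1 \<subseteq> (\<Union>x\<in>K. ball x (1/2))"
    unfolding compact_eq_totally_bounded by (meson half_gt_zero zero_less_one)
  have half: "cball c r \<subseteq> (\<Union>y\<in>(\<lambda>x. c + r *\<^sub>R x) ` K. cball y (r / 2))" if "r > 0" for c :: 'k and r
  proof
    fix z assume "z \<in> cball c r"
    then have "(1 / r) *\<^sub>R (z - c) \<in> cball 0 1"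
      using that by (simp add: dist_norm norm_minus_commute divide_le_eq)
    then have "(1 / r) *\<^sub>R (z - c) \<in> (\<Union>x\<in>K. ball x (1/2))" using K(2) by (rule rev_subsetD)
    then obtain x where x: "x \<in> K" "dist x ((1 / r) *\<^sub>R (z - c)) < 1/2"
      unfolding UN_iff mem_ball by blast
    have "(c + r *\<^sub>R x) - z = r *\<^sub>R (x - (1 / r) *\<^sub>R (z - c))"
      using that by (simp add: algebra_simps)
    then have "dist (c + r *\<^sub>R x) z = r * dist x ((1 / r) *\<^sub>R (z - c))"
      using that by (simp add: dist_norm)
    also have "\<dots> \<le> r * (1/2)" using x(2) that by (intro mult_left_mono) auto
    finally show "z \<in> (\<Union>y\<in>(\<lambda>x. c + r *\<^sub>R x) ` K. cball y (r / 2))" using x(1) by auto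
  qed
  have "\<exists>C. finite C \<and> card C \<le> card K ^ j \<and> cball c r \<subseteq> (\<Union>y\<in>C. cball y (r / 2 ^ j))"
    if "r > 0" for c :: 'k and r j
  proof (induction j)
    case 0
    show ?case by (rule exI[of _ "{c}"]) simp
  next
    case (Suc j)
    then obtain C where C: "finite C" "card C \<le> card K ^ j"
      "cball c r \<subseteq> (\<Union>y\<in>C. cball y (r / 2 ^ j))" by blast
    let ?D = "\<Union>y\<in>C. (\<lambda>x. y + (r / 2 ^ j) *\<^sub>R x) ` K"
    have "card ?D \<le> (\<Sum>y\<in>C. card ((\<lambda>x. y + (r / 2 ^ j) *\<^sub>R x) ` K))"
      using C(1) by (rule card_UN_le)
    also have "\<dots> \<le> card C * card K"
      using sum_bounded_above[of C "\<lambda>y. card ((\<lambda>x. y + (r / 2 ^ j) *\<^sub>R x) ` K)" "card K",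
          OF card_image_le[OF K(1)]] by simp
    also have "\<dots> \<le> card K ^ Suc j" using C(2) by (simp add: mult.commute)
    finally have "card ?D \<le> card K ^ Suc j" .
    moreover have "finite ?D" using C(1) K(1) by blast
    moreover have "cball c r \<subseteq> (\<Union>y\<in>?D. cball y (r / 2 ^ Suc j))"
    proof
      fix z assume "z \<in> cball c r"
      then obtain y where y: "y \<in> C" "z \<in> cball y (r / 2 ^ j)" using C(3) by blast
      have "r / 2 ^ j > 0" using that by simp
      from subsetD[OF half[OF this] y(2)] y(1)
      show "z \<in> (\<Union>y\<in>?D. cball y (r / 2 ^ Suc j))" by (auto simp: field_simps)
    qed
    ultimately show ?case by blast
  qed
  then show ?thesis by (rule that)
qed

text \<open>Each power of n is at most the top one, so the sum of the absolute coefficients is a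
  constant. Strictness and \<open>C \<ge> 1\<close> let \<open>{..<C * n ^ q}\<close> serve as a
  nonempty range containing all admissible indices.\<close>

lemma poly_less_monomial:
  fixes P :: "real poly"
  obtains C q :: nat where "C \<ge> 1" "\<And>n. n \<ge> 1 \<Longrightarrow> poly P (real n) < real (C * n ^ q)"
proof -
  define S where "S = (\<Sum>i\<le>degree P. \<bar>coeff P i\<bar>)"
  obtain C :: nat where C: "S < real C" using reals_Archimedean2 by blast
  have "S \<ge> 0" unfolding S_def by (intro sum_nonneg) auto
  have "poly P (real n) < real (C * n ^ degree P)" if "n \<ge> 1" for n
  proof -
    have "poly P (real n) = (\<Sum>i\<le>degree P. coeff P i * real n ^ i)" by (rule poly_altdef)
    also have "\<dots> \<le> (\<Sum>i\<le>degree P. \<bar>coeff P i\<bar> * real n ^ degree P)"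
      using that by (intro sum_mono mult_mono power_increasing) auto
    also have "\<dots> = S * real n ^ degree P" by (simp add: S_def sum_distrib_right)
    also have "\<dots> < real C * real n ^ degree P" using C that by (intro mult_strict_right_mono) auto
    finally show ?thesis by simp
  qed
  moreover have "C \<ge> 1" using C \<open>S \<ge> 0\<close> by simp
  ultimately show ?thesis using that by blast
qed

section \<open>Quasi-norms of long sums\<close>

text \<open>A modulus of concavity of the form \<open>2\<^sup>\<kappa>\<close> turns the constant of the iterated
  quasi-triangle inequality for \<open>n\<close> summands into a power of \<open>n\<close>.\<close>

locale quasi_normed_modulus = quasi_normed_space smul qnorm
  for smul :: "'k::{real_normed_field, euclidean_space} \<Rightarrow> 'v::ab_group_add \<Rightarrow> 'v"
    and qnorm :: "'v \<Rightarrow> real" +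
  fixes \<kappa> :: nat
  assumes qnorm_add: "qnorm (x + y) \<le> 2 ^ \<kappa> * (qnorm x + qnorm y)"
begin

lemma qnorm_minus: "qnorm (- x) = qnorm x"
  using qnorm_scale[of "-1" x] by simp

lemma qnorm_diff: "qnorm (x - y) \<le> 2 ^ \<kappa> * (qnorm x + qnorm y)"
  using qnorm_add[of x "- y"] by (simp add: qnorm_minus)

lemma qnorm_commute: "qnorm (x - y) = qnorm (y - x)"
  using qnorm_minus[of "x - y"] by simp

lemma qnorm_triangle: "qnorm (x - z) \<le> 2 ^ \<kappa> * (qnorm (x - y) + qnorm (y - z))"
  using qnorm_add[of "x - y" "y - z"] by simp

text \<open>Splitting the sum into halves costs one factor \<open>2 ^ \<kappa>\<close> per level, so
  the depth \<open>l\<close> enters the exponent and not the number of summands.\<close>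

lemma qnorm_sum_dyadic:
  assumes "finite J" "card J \<le> 2 ^ l"
  shows "qnorm (sum f J) \<le> (2 ^ \<kappa>) ^ l * (\<Sum>j\<in>J. qnorm (f j))"
  using assms
proof (induction l arbitrary: J)
  case 0
  then have "card J \<le> 1" by simp
  then have "card J = 0 \<or> card J = 1" by linarith
  then show ?case
  proof
    assume "card J = 0"
    then show ?thesis using 0 qnorm_eq_0_iff[of 0] by simp
  next
    assume "card J = 1"
    then show ?thesis by (auto simp: card_1_singleton_iff)
  qed
next
  case (Suc l)
  have "\<exists>A\<subseteq>J. card A \<le> 2 ^ l \<and> card J - card A \<le> 2 ^ l"
  proof (cases "card J \<le> 2 ^ l")
    case True
    then show ?thesis by auto
  next
    case False
    then obtain A where "A \<subseteq> J" "card A = 2 ^ l"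
      by (meson nat_le_linear obtain_subset_with_card_n)
    then show ?thesis using Suc.prems(2) by auto
  qed
  then obtain A where A: "A \<subseteq> J" "card A \<le> 2 ^ l" "card J - card A \<le> 2 ^ l" by blast
  have fin: "finite A" "finite (J - A)" using Suc.prems(1) A(1) finite_subset by auto
  have "card (J - A) \<le> 2 ^ l" using A fin by (simp add: card_Diff_subset)
  note IH = Suc.IH[OF fin(1) A(2)] Suc.IH[OF fin(2) this]
  have split: "sum h J = sum h A + sum h (J - A)" for h :: "_ \<Rightarrow> 'x::comm_monoid_add"
    using A(1) Suc.prems(1) by (metis add.commute sum.subset_diff)
  have "qnorm (sum f J) \<le> 2 ^ \<kappa> * (qnorm (sum f A) + qnorm (sum f (J - A)))"
    unfolding split[of f] by (rule qnorm_add)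
  also have "\<dots> \<le> 2 ^ \<kappa> * ((2 ^ \<kappa>) ^ l * (\<Sum>j\<in>A. qnorm (f j)) + (2 ^ \<kappa>) ^ l * (\<Sum>j\<in>J - A. qnorm (f j)))"
    using IH by (intro mult_left_mono add_mono) auto
  also have "\<dots> = (2 ^ \<kappa>) ^ Suc l * (\<Sum>j\<in>J. qnorm (f j))"
    unfolding split[of "\<lambda>j. qnorm (f j)"] by (simp add: algebra_simps)
  finally show ?case .
qed

text \<open>For \<open>2 ^ l \<le> n < 2 ^ (l + 1)\<close> a tree of depth \<open>l + 1\<close>
  suffices, with constant \<open>(2 ^ (l + 1)) ^ \<kappa> \<le> (2 * n) ^ \<kappa>\<close>. The
  remaining factor bounds the number of summands.\<close>

lemma qnorm_sum_le:
  assumes "finite J" "card J \<le> n" "n \<ge> 1" "\<And>j. j \<in> J \<Longrightarrow> qnorm (f j) \<le> \<delta>" "\<delta> \<ge> 0"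
  shows "qnorm (sum f J) \<le> (2 * real n) ^ Suc \<kappa> * \<delta>"
proof -
  obtain l where l: "2 ^ l \<le> n" "n < 2 ^ (l + 1)" using ex_power_ivl1[of 2 n] assms(3) by auto
  have "card J \<le> 2 ^ (l + 1)" using assms(2) l(2) by linarith
  from qnorm_sum_dyadic[OF assms(1) this, of f]
  have "qnorm (sum f J) \<le> (2 ^ (l + 1)) ^ \<kappa> * (\<Sum>j\<in>J. qnorm (f j))"
    by (simp flip: power_mult add: mult.commute)
  also have "\<dots> \<le> (2 * real n) ^ \<kappa> * (2 * real n * \<delta>)"
  proof (intro mult_mono power_mono)
    have "(2::real) ^ l \<le> real n" using l(1) by (metis of_nat_le_iff of_nat_numeral of_nat_power)
    then show "(2::real) ^ (l + 1) \<le> 2 * real n" by simp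
    have "(\<Sum>j\<in>J. qnorm (f j)) \<le> real (card J) * \<delta>" using assms(4) by (rule sum_bounded_above)
    also have "\<dots> \<le> 2 * real n * \<delta>" using assms(2,5) by (intro mult_right_mono) auto
    finally show "(\<Sum>j\<in>J. qnorm (f j)) \<le> 2 * real n * \<delta>" .
  qed (auto intro: sum_nonneg qnorm_nonneg)
  finally show ?thesis by (simp add: mult_ac)
qed

section \<open>Linear combinations and Riesz bases\<close>

text \<open>Vectors and coefficients are total functions of which only the first \<open>m\<close>
  values count, so one coefficient function can be read against every initial segment of a
  basis.\<close>

definition lincomb :: "(nat \<Rightarrow> 'v) \<Rightarrow> nat \<Rightarrow> (nat \<Rightarrow> 'k) \<Rightarrow> 'v" where
  "lincomb e m a = (\<Sum>i<m. smul (a i) (e i))"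

lemma lincomb_add: "lincomb e m (\<lambda>i. a i + b i) = lincomb e m a + lincomb e m b"
  by (simp add: lincomb_def scale_left_distrib sum.distrib)

lemma lincomb_diff: "lincomb e m (\<lambda>i. a i - b i) = lincomb e m a - lincomb e m b"
  by (simp add: lincomb_def scale_left_diff_distrib sum_subtractf)

lemma lincomb_scale: "lincomb e m (\<lambda>i. c * a i) = smul c (lincomb e m a)"
  by (simp add: lincomb_def scale_sum_right)

lemma lincomb_cong:
  "(\<And>i. i < m \<Longrightarrow> e i = e' i) \<Longrightarrow> (\<And>i. i < m \<Longrightarrow> a i = a' i) \<Longrightarrow> lincomb e m a = lincomb e' m a'"
  unfolding lincomb_def by (intro sum.cong) auto

lemma lincomb_Suc: "lincomb e (Suc m) a = lincomb e m a + smul (a m) (e m)"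
  by (simp add: lincomb_def)

text \<open>Each new vector is chosen as in Riesz' lemma. A vector at distance \<open>0\<close> from the span of the
  previous ones is dropped; this is why the combinations are only claimed to be dense, and
  closedness of finite-dimensional subspaces is not needed.\<close>

lemma ex_riesz_flag:
  assumes "finite G"
  shows "\<exists>m e. m \<le> card G \<and> (\<forall>i<m. qnorm (e i) \<le> 1) \<and>
    (\<forall>i<m. \<forall>a. norm (a i) \<le> 2 * qnorm (lincomb e (Suc i) a)) \<and>
    (\<forall>x\<in>span G. \<forall>\<theta>>0. \<exists>a. qnorm (x - lincomb e m a) \<le> \<theta>)"
  using assms
proof (induction G rule: finite_induct)
  case empty
  have "\<forall>x\<in>span {}. \<forall>\<theta>>0. \<exists>a. qnorm (x - lincomb (\<lambda>_. 0) 0 a) \<le> \<theta>"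
    using qnorm_eq_0_iff[of 0] by (simp add: lincomb_def)
  then show ?case by (intro exI[of _ 0] exI[of _ "\<lambda>_. 0"]) simp
next
  case (insert v G)
  then obtain m e where m: "m \<le> card G" and e1: "\<And>i. i < m \<Longrightarrow> qnorm (e i) \<le> 1"
    and flag: "\<And>i a. i < m \<Longrightarrow> norm (a i) \<le> 2 * qnorm (lincomb e (Suc i) a)"
    and dense: "\<And>x \<theta>. x \<in> span G \<Longrightarrow> \<theta> > 0 \<Longrightarrow> \<exists>a. qnorm (x - lincomb e m a) \<le> \<theta>"
    by blast
  \<comment> \<open>\<open>d\<close> is the distance of \<open>v\<close> from the combinations found
    so far; it need not be attained.\<close>
  define X where "X = range (\<lambda>a. qnorm (v - lincomb e m a))"
  define d where "d = Inf X"
  have bdd: "bdd_below X" unfolding X_def by (rule bdd_belowI[of _ 0]) (auto simp: qnorm_nonneg)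
  have ne: "X \<noteq> {}" by (simp add: X_def)
  have d_le: "d \<le> qnorm (v - lincomb e m a)" for a
    unfolding d_def using bdd by (rule cInf_lower[rotated]) (simp add: X_def)
  have d_nonneg: "d \<ge> 0" unfolding d_def using ne by (rule cInf_greatest) (auto simp: X_def qnorm_nonneg)
  have near: "\<exists>a. qnorm (v - lincomb e m a) < t" if "d < t" for t
    using that cInf_less_iff[OF ne bdd] unfolding d_def X_def by auto
  show ?case
  proof (cases "d = 0")
    case True
    have "\<exists>a. qnorm (x - lincomb e m a) \<le> \<theta>" if x: "x \<in> span (insert v G)" and "\<theta> > 0" for x \<theta>
    proof -
      obtain c where c: "x - smul c v \<in> span G" using x span_breakdown_eq by blast
      define \<theta>' where "\<theta>' = \<theta> / (2 ^ \<kappa> * 2)"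
      have "\<theta>' > 0" using \<open>\<theta> > 0\<close> by (simp add: \<theta>'_def)
      obtain a where a: "qnorm (x - smul c v - lincomb e m a) \<le> \<theta>'" using dense[OF c \<open>\<theta>' > 0\<close>] by blast
      \<comment> \<open>The error in approximating \<open>v\<close> gets multiplied by
        \<open>norm c\<close>; adding 1 keeps the divisor positive when \<open>c\<close> is
        0.\<close>
      have pos: "norm c + 1 > 0" using norm_ge_zero[of c] by linarith
      then have "d < \<theta>' / (norm c + 1)" using \<open>\<theta>' > 0\<close> True by simp
      from near[OF this] obtain b where b: "qnorm (v - lincomb e m b) < \<theta>' / (norm c + 1)" by blast
      have "norm c * qnorm (v - lincomb e m b) \<le> (norm c + 1) * (\<theta>' / (norm c + 1))"
        using b by (intro mult_mono) (auto simp: qnorm_nonneg)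
      also have "\<dots> = \<theta>'" using pos by simp
      finally have b': "qnorm (smul c (v - lincomb e m b)) \<le> \<theta>'" by (simp add: qnorm_scale)
      have "x - lincomb e m (\<lambda>i. a i + c * b i) =
          (x - smul c v - lincomb e m a) + smul c (v - lincomb e m b)"
        by (simp add: lincomb_add lincomb_scale scale_right_diff_distrib)
      then have "qnorm (x - lincomb e m (\<lambda>i. a i + c * b i)) \<le> 2 ^ \<kappa> * (\<theta>' + \<theta>')"
        using qnorm_add[of "x - smul c v - lincomb e m a" "smul c (v - lincomb e m b)"] a b'
        by (smt (verit) mult_left_mono zero_le_power)
      also have "\<dots> = \<theta>" by (simp add: \<theta>'_def)
      finally show ?thesis by blast
    qed
    moreover have "m \<le> card (insert v G)" using m insert.hyps by simp
    ultimately show ?thesis using e1 flag by blast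
  next
    case False
    then have "d > 0" using d_nonneg by simp
    \<comment> \<open>Missing the distance by a factor less than 2 is the source of the constant 2
      in the flag property.\<close>
    then obtain a0 where a0: "qnorm (v - lincomb e m a0) < 2 * d" using near[of "2 * d"] by auto
    define r where "r = qnorm (v - lincomb e m a0)"
    have r: "r > 0" "r < 2 * d" using a0 d_le[of a0] \<open>d > 0\<close> by (auto simp: r_def)
    \<comment> \<open>The residual of \<open>v\<close>, scaled to quasi-norm 1, becomes the vector
      with index \<open>m\<close>.\<close>
    define e' where "e' = e(m := smul (of_real (inverse r)) (v - lincomb e m a0))"
    have e'_eq: "lincomb e' j a = lincomb e j a" if "j \<le> m" for j a
      using that by (intro lincomb_cong) (auto simp: e'_def)
    have top: "lincomb e' (Suc m) a = lincomb e m a + smul (a m * of_real (inverse r)) (v - lincomb e m a0)" for a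
      by (simp add: lincomb_Suc e'_eq) (simp add: e'_def)
    have "qnorm (e' i) \<le> 1" if "i < Suc m" for i
      using that e1 r by (cases "i = m") (auto simp: e'_def qnorm_scale norm_inverse simp flip: r_def)
    moreover have "norm (a i) \<le> 2 * qnorm (lincomb e' (Suc i) a)" if "i < Suc m" for i a
    proof (cases "i < m")
      case True
      then show ?thesis using flag e'_eq by simp
    next
      case False
      then have i: "i = m" using that by simp
      show ?thesis
      proof (cases "a m = 0")
        case True
        then show ?thesis by (simp add: i qnorm_nonneg)
      next
        case nz: False
        \<comment> \<open>\<open>c\<close> is the coefficient of \<open>v\<close> in the
          combination. Dividing by it leaves \<open>v\<close> minus a combination of the earlier
          vectors, of quasi-norm at least \<open>d\<close>.\<close>
        define c where "c = a m * of_real (inverse r)"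
        have c: "c \<noteq> 0" "norm c = norm (a m) / r"
          using nz r by (auto simp: c_def norm_mult norm_inverse divide_inverse)
        have "lincomb e m a = smul c (lincomb e m (\<lambda>j. inverse c * a j))"
          using c by (simp add: lincomb_scale)
        then have "lincomb e' (Suc m) a = smul c (v - lincomb e m (\<lambda>j. a0 j - inverse c * a j))"
          unfolding top c_def[symmetric] lincomb_diff by (simp add: scale_right_diff_distrib)
        then have "qnorm (lincomb e' (Suc m) a) = norm c * qnorm (v - lincomb e m (\<lambda>j. a0 j - inverse c * a j))"
          by (simp add: qnorm_scale)
        also have "\<dots> \<ge> norm c * d" using d_le by (intro mult_left_mono) auto
        finally have "norm c * d \<le> qnorm (lincomb e' (Suc m) a)" .
        moreover have "norm (a m) \<le> 2 * (norm c * d)"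
        proof -
          have "norm (a m) * r \<le> norm (a m) * (2 * d)" using r by (intro mult_left_mono) auto
          then show ?thesis using r by (simp add: c field_simps)
        qed
        ultimately show ?thesis unfolding i by linarith
      qed
    qed
    moreover have "\<exists>a. qnorm (x - lincomb e' (Suc m) a) \<le> \<theta>"
      if x: "x \<in> span (insert v G)" and "\<theta> > 0" for x \<theta>
    proof -
      obtain c where c: "x - smul c v \<in> span G" using x span_breakdown_eq by blast
      obtain a where a: "qnorm (x - smul c v - lincomb e m a) \<le> \<theta>" using dense[OF c \<open>\<theta> > 0\<close>] by blast
      \<comment> \<open>The top coefficient \<open>c * r\<close> reproduces \<open>smul c v\<close>
        minus \<open>c\<close> times the combination \<open>a0\<close>; the lower coefficients add
        the latter back, so the error is exactly that of \<open>a\<close>.\<close>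
      define b where "b = (\<lambda>i. if i < m then a i + c * a0 i else c * of_real r)"
      have "lincomb e m b = lincomb e m (\<lambda>i. a i + c * a0 i)"
        by (intro lincomb_cong) (auto simp: b_def)
      moreover have "b m * of_real (inverse r) = c" using r by (simp add: b_def)
      ultimately have "x - lincomb e' (Suc m) b = x - smul c v - lincomb e m a"
        unfolding top by (simp add: lincomb_add lincomb_scale scale_right_diff_distrib)
      then show ?thesis using a by metis
    qed
    moreover have "Suc m \<le> card (insert v G)" using m insert.hyps by simp
    ultimately show ?thesis by blast
  qed
qed

section \<open>Covering balls of finite-dimensional subspaces\<close>

text \<open>The coefficients are discretised from the last one downwards. Once those with index at least
  \<open>m\<close> are fixed up to \<open>\<delta>\<close>, the error they contribute is at most \<open>E\<close> in total, whence the flag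
  property confines coefficient \<open>m - 1\<close> to a ball whose radius does not deteriorate with \<open>m\<close>.\<close>

lemma coefficient_partition:
  fixes A :: "(nat \<Rightarrow> 'k) set"
  assumes flag: "\<And>i a. i < M \<Longrightarrow> norm (a i) \<le> 2 * qnorm (lincomb e (Suc i) a)"
    and err: "\<And>m a. m \<le> M \<Longrightarrow> \<forall>j\<in>{m..<M}. norm (a j) \<le> \<delta> \<Longrightarrow>
      qnorm (\<Sum>j\<in>{m..<M}. smul (a j) (e j)) \<le> E"
    and cover: "\<And>c::'k. \<exists>C. finite C \<and> card C \<le> N \<and>
      cball c (2 * (2 ^ \<kappa> * (D + E))) \<subseteq> (\<Union>y\<in>C. cball y (\<delta> / 2))"
    and "m \<le> M"
    and "\<And>a b. a \<in> A \<Longrightarrow> b \<in> A \<Longrightarrow> qnorm (lincomb e M (\<lambda>j. a j - b j)) \<le> D"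
    and "\<And>a b j. a \<in> A \<Longrightarrow> b \<in> A \<Longrightarrow> j \<in> {m..<M} \<Longrightarrow> norm (a j - b j) \<le> \<delta>"
  shows "\<exists>F. finite F \<and> card F \<le> N ^ m \<and> A \<subseteq> \<Union>F \<and>
    (\<forall>T\<in>F. \<forall>a\<in>T. \<forall>b\<in>T. \<forall>j<M. norm (a j - b j) \<le> \<delta>)"
  using assms(4-6)
proof (induction m arbitrary: A)
  case 0
  then show ?case by (intro exI[of _ "{A}"]) auto
next
  case (Suc m)
  show ?case
  proof (cases "A = {}")
    case True
    then show ?thesis by (intro exI[of _ "{}"]) auto
  next
    case False
    then obtain a0 where a0: "a0 \<in> A" by blast
    obtain C where C: "finite C" "card C \<le> N"
      "cball (a0 m) (2 * (2 ^ \<kappa> * (D + E))) \<subseteq> (\<Union>y\<in>C. cball y (\<delta> / 2))"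
      using cover by blast
    \<comment> \<open>The difference of two members of \<open>A\<close> has a combination bounded by
      \<open>D\<close> and a tail bounded by \<open>E\<close>. Its initial segment up to index
      \<open>m\<close> is thus bounded, and the flag property reads off coefficient
      \<open>m\<close>.\<close>
    have in_ball: "a m \<in> cball (a0 m) (2 * (2 ^ \<kappa> * (D + E)))" if "a \<in> A" for a
    proof -
      define b where "b j = a0 j - a j" for j
      have "lincomb e M b = lincomb e (Suc m) b + (\<Sum>j\<in>{Suc m..<M}. smul (b j) (e j))"
        unfolding lincomb_def lessThan_atLeast0 using Suc.prems(1) by (intro sum.atLeastLessThan_concat[symmetric]) auto
      then have "lincomb e (Suc m) b = lincomb e M b - (\<Sum>j\<in>{Suc m..<M}. smul (b j) (e j))" by simp
      then have "qnorm (lincomb e (Suc m) b) \<le>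
          2 ^ \<kappa> * (qnorm (lincomb e M b) + qnorm (\<Sum>j\<in>{Suc m..<M}. smul (b j) (e j)))"
        using qnorm_diff by metis
      also have "\<dots> \<le> 2 ^ \<kappa> * (D + E)"
      proof (intro mult_left_mono add_mono)
        show "qnorm (lincomb e M b) \<le> D" unfolding b_def using Suc.prems(2)[OF a0 that] .
        show "qnorm (\<Sum>j\<in>{Suc m..<M}. smul (b j) (e j)) \<le> E"
          using Suc.prems(1) Suc.prems(3)[OF a0 that] by (intro err) (auto simp: b_def)
      qed simp
      finally have "norm (b m) \<le> 2 * (2 ^ \<kappa> * (D + E))"
        using flag[of m b] Suc.prems(1) by simp
      then show ?thesis by (simp add: b_def dist_norm)
    qed
    \<comment> \<open>Members of one \<open>S y\<close> agree up to \<delta> in coefficient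
      \<open>m\<close> too, which is what the induction hypothesis needs for the next lower
      index.\<close>
    define S where "S y = {a \<in> A. a m \<in> cball y (\<delta> / 2)}" for y
    have "\<exists>F. finite F \<and> card F \<le> N ^ m \<and> S y \<subseteq> \<Union>F \<and>
      (\<forall>T\<in>F. \<forall>a\<in>T. \<forall>b\<in>T. \<forall>j<M. norm (a j - b j) \<le> \<delta>)" for y
    proof (rule Suc.IH)
      show "m \<le> M" using Suc.prems(1) by simp
      show "qnorm (lincomb e M (\<lambda>j. a j - b j)) \<le> D" if "a \<in> S y" "b \<in> S y" for a b
        using that Suc.prems(2) by (simp add: S_def)
      show "norm (a j - b j) \<le> \<delta>" if "a \<in> S y" "b \<in> S y" "j \<in> {m..<M}" for a b j
      proof (cases "j = m")
        case True
        have "dist y (a m) \<le> \<delta> / 2" "dist y (b m) \<le> \<delta> / 2" using that by (auto simp: S_def)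
        then have "dist (a m) (b m) \<le> \<delta>" using dist_triangle3[of "a m" "b m" y] by linarith
        then show ?thesis by (simp add: True dist_norm)
      next
        case False
        then show ?thesis using that Suc.prems(3) by (simp add: S_def)
      qed
    qed
    then obtain F where F: "\<And>y. finite (F y) \<and> card (F y) \<le> N ^ m \<and> S y \<subseteq> \<Union>(F y) \<and>
      (\<forall>T\<in>F y. \<forall>a\<in>T. \<forall>b\<in>T. \<forall>j<M. norm (a j - b j) \<le> \<delta>)" by metis
    have "card (\<Union>(F ` C)) \<le> (\<Sum>y\<in>C. card (F y))" using C(1) by (rule card_UN_le)
    also have "\<dots> \<le> card C * N ^ m" using sum_bounded_above[of C "\<lambda>y. card (F y)" "N ^ m"] F by simp
    also have "\<dots> \<le> N ^ Suc m" using C(2) by simp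
    finally have "card (\<Union>(F ` C)) \<le> N ^ Suc m" .
    moreover have "finite (\<Union>(F ` C))" using C(1) F by blast
    moreover have "A \<subseteq> \<Union>(\<Union>(F ` C))"
    proof
      fix a assume "a \<in> A"
      from subsetD[OF C(3) in_ball[OF this]] obtain y where y: "y \<in> C" "a m \<in> cball y (\<delta> / 2)"
        by (elim UN_E)
      then have "a \<in> S y" using \<open>a \<in> A\<close> by (simp add: S_def)
      then have "a \<in> \<Union>(F y)" using F by (meson subsetD)
      then show "a \<in> \<Union>(\<Union>(F ` C))" using y(1) by (meson UN_I UnionE UnionI)
    qed
    moreover have "\<forall>T\<in>\<Union>(F ` C). \<forall>a\<in>T. \<forall>b\<in>T. \<forall>j<M. norm (a j - b j) \<le> \<delta>"
      using F by (meson UN_E)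
    ultimately show ?thesis by (intro exI[of _ "\<Union>(F ` C)"] conjI)
  qed
qed

text \<open>Points of the ball are replaced by nearby combinations, whose coefficients are
  partitioned. \<delta> is chosen so that up to n coefficient errors add up to a fixed fraction of
  \<epsilon>, and \<open>D\<close> bounds the difference of two combinations close to the
  ball.\<close>

lemma diam_cover_span:
  assumes G: "finite G" "card G \<le> n" and n: "n \<ge> 1" and R: "R > 0" and \<epsilon>: "0 < \<epsilon>" "\<epsilon> \<le> 1"
    and \<delta>: "\<delta> = \<epsilon> / (4 * (2 ^ \<kappa>)\<^sup>2 * (2 * real n) ^ Suc \<kappa>)"
    and D: "D = 2 * (2 ^ \<kappa>)\<^sup>2 * (R + 1)"
    and N: "N \<ge> 1"
    and cover: "\<And>c::'k. \<exists>C. finite C \<and> card C \<le> N \<and>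
      cball c (2 * (2 ^ \<kappa> * (D + 1))) \<subseteq> (\<Union>y\<in>C. cball y (\<delta> / 2))"
  shows "diam_cover qnorm (qcball qnorm x R \<inter> span G) (N ^ n) \<epsilon>"
proof -
  obtain M e where M: "M \<le> card G" and e1: "\<And>i. i < M \<Longrightarrow> qnorm (e i) \<le> 1"
    and flag: "\<And>i a. i < M \<Longrightarrow> norm (a i) \<le> 2 * qnorm (lincomb e (Suc i) a)"
    and dense: "\<And>x \<theta>. x \<in> span G \<Longrightarrow> \<theta> > 0 \<Longrightarrow> \<exists>a. qnorm (x - lincomb e M a) \<le> \<theta>"
    using ex_riesz_flag[OF G(1)] by blast
  define K where "K = (2::real) ^ \<kappa>"
  have K: "K \<ge> 1" by (simp add: K_def)
  \<comment> \<open>Two points of one piece are joined by three steps of size at most \<theta>,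
    hence are at distance at most 3 K^2 \<theta> = 3/4 \<epsilon>.\<close>
  define \<theta> where "\<theta> = \<epsilon> / (4 * K\<^sup>2)"
  have \<theta>0: "\<theta> > 0" using \<epsilon> K by (simp add: \<theta>_def)
  have "1 \<le> K\<^sup>2" using K by simp
  then have "\<epsilon> \<le> 4 * K\<^sup>2" using \<epsilon> by linarith
  then have \<theta>1: "\<theta> \<le> 1" using K by (simp add: \<theta>_def divide_le_eq)
  have \<delta>0: "\<delta> \<ge> 0" using \<epsilon> by (simp add: \<delta>)
  have \<delta>\<theta>: "(2 * real n) ^ Suc \<kappa> * \<delta> = \<theta>" using n by (simp add: \<delta> \<theta>_def K_def)
  have err: "qnorm (\<Sum>j\<in>{m..<M}. smul (a j) (e j)) \<le> \<theta>"
    if "\<forall>j\<in>{m..<M}. norm (a j) \<le> \<delta>" for m a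
  proof -
    have "qnorm (smul (a j) (e j)) \<le> \<delta>" if "j \<in> {m..<M}" for j
      using mult_mono[of "norm (a j)" \<delta> "qnorm (e j)" 1] that e1[of j] \<delta>0
        \<open>\<forall>j\<in>{m..<M}. norm (a j) \<le> \<delta>\<close>
      by (auto simp: qnorm_scale qnorm_nonneg)
    then show ?thesis unfolding \<delta>\<theta>[symmetric]
      using M G n \<delta>0 by (intro qnorm_sum_le) auto
  qed
  define B where "B = qcball qnorm x R \<inter> span G"
  \<comment> \<open>All coefficients approximating some point of the ball are taken; exact
    representations may be missing because the combinations are only dense.\<close>
  define A where "A = {a. \<exists>y\<in>B. qnorm (y - lincomb e M a) \<le> \<theta>}"
  have A_near: "qnorm (x - lincomb e M a) \<le> K * (R + 1)" if a: "a \<in> A" for a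
  proof -
    obtain y where y: "qnorm (x - y) \<le> R" "qnorm (y - lincomb e M a) \<le> \<theta>"
      using a unfolding A_def B_def qcball_def by blast
    have "qnorm (x - lincomb e M a) \<le> K * (qnorm (x - y) + qnorm (y - lincomb e M a))"
      unfolding K_def by (rule qnorm_triangle)
    also have "\<dots> \<le> K * (R + 1)" using y \<theta>1 K by (intro mult_left_mono) auto
    finally show ?thesis .
  qed
  have "\<exists>F. finite F \<and> card F \<le> N ^ M \<and> A \<subseteq> \<Union>F \<and>
    (\<forall>T\<in>F. \<forall>a\<in>T. \<forall>b\<in>T. \<forall>j<M. norm (a j - b j) \<le> \<delta>)"
  \<comment> \<open>The tail error is in fact at most \<theta>; the coarser bound 1 makes the radius
    to be covered independent of n and \<epsilon>.\<close>
  proof (rule coefficient_partition[OF flag, where E = 1 and D = D])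
    show "qnorm (\<Sum>j\<in>{m..<M}. smul (a j) (e j)) \<le> 1"
      if "\<forall>j\<in>{m..<M}. norm (a j) \<le> \<delta>" for m a
      using err[OF that] \<theta>1 by linarith
    show "qnorm (lincomb e M (\<lambda>j. a j - b j)) \<le> D" if "a \<in> A" "b \<in> A" for a b
    proof -
      have "qnorm (lincomb e M (\<lambda>j. a j - b j)) = qnorm ((x - lincomb e M b) - (x - lincomb e M a))"
        by (simp add: lincomb_diff)
      also have "\<dots> \<le> K * (qnorm (x - lincomb e M b) + qnorm (x - lincomb e M a))"
        unfolding K_def by (rule qnorm_diff)
      also have "\<dots> \<le> K * (K * (R + 1) + K * (R + 1))"
        using A_near that K by (intro mult_left_mono add_mono) auto
      also have "\<dots> = D" by (simp add: D K_def power2_eq_square algebra_simps)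
      finally show ?thesis .
    qed
  qed (use cover in auto)
  then obtain F where F: "finite F" "card F \<le> N ^ M" "A \<subseteq> \<Union>F"
    "\<forall>T\<in>F. \<forall>a\<in>T. \<forall>b\<in>T. \<forall>j<M. norm (a j - b j) \<le> \<delta>"
    by blast
  \<comment> \<open>\<open>H\<close> carries a piece of coefficient space back to the
    \<theta>-neighbourhood of its combinations.\<close>
  define H where "H T = {y. \<exists>a\<in>T. qnorm (y - lincomb e M a) \<le> \<theta>}" for T
  have "card (H ` F) \<le> N ^ n"
  proof -
    have "card (H ` F) \<le> card F" using F(1) by (rule card_image_le)
    also have "\<dots> \<le> N ^ M" by (rule F(2))
    also have "\<dots> \<le> N ^ n" using N M G(2) by (intro power_increasing) auto
    finally show ?thesis .
  qed
  moreover have "finite (H ` F)" using F(1) by simp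
  moreover have "B \<subseteq> \<Union>(H ` F)"
  proof
    fix y assume y: "y \<in> B"
    then obtain a where a: "qnorm (y - lincomb e M a) \<le> \<theta>" using dense[of y \<theta>] \<theta>0 by (auto simp: B_def)
    then have "a \<in> A" using y by (auto simp: A_def)
    then show "y \<in> \<Union>(H ` F)" using F(3) a by (auto simp: H_def)
  qed
  moreover have "qnorm (y - z) \<le> \<epsilon>" if "T \<in> F" "y \<in> H T" "z \<in> H T" for T y z
  proof -
    obtain a b where ab: "a \<in> T" "b \<in> T" "qnorm (y - lincomb e M a) \<le> \<theta>" "qnorm (z - lincomb e M b) \<le> \<theta>"
      using \<open>y \<in> H T\<close> \<open>z \<in> H T\<close> by (auto simp: H_def)
    have "qnorm (lincomb e M (\<lambda>j. a j - b j)) \<le> \<theta>"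
      unfolding lincomb_def lessThan_atLeast0 using F(4) \<open>T \<in> F\<close> ab(1,2) by (intro err) auto
    then have mid: "qnorm (lincomb e M a - lincomb e M b) \<le> \<theta>" by (simp add: lincomb_diff)
    have "qnorm (lincomb e M a - z) \<le> K * (qnorm (lincomb e M a - lincomb e M b) + qnorm (lincomb e M b - z))"
      unfolding K_def by (rule qnorm_triangle)
    also have "\<dots> \<le> K * (\<theta> + \<theta>)"
      using mid ab(4) K by (intro mult_left_mono add_mono) (auto simp: qnorm_commute)
    finally have *: "qnorm (lincomb e M a - z) \<le> K * (\<theta> + \<theta>)" .
    have "qnorm (y - z) \<le> K * (qnorm (y - lincomb e M a) + qnorm (lincomb e M a - z))"
      unfolding K_def by (rule qnorm_triangle)
    also have "\<dots> \<le> K * (K * \<theta> + K * (\<theta> + \<theta>))"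
    proof (intro mult_left_mono add_mono *)
      have "1 * \<theta> \<le> K * \<theta>" using K \<theta>0 by (intro mult_right_mono) auto
      then show "qnorm (y - lincomb e M a) \<le> K * \<theta>" using ab(3) by simp
    qed (use K in auto)
    also have "\<dots> = 3/4 * \<epsilon>" using K by (simp add: \<theta>_def power2_eq_square field_simps)
    finally show ?thesis using \<epsilon> by simp
  qed
  then have "\<forall>T\<in>H ` F. \<forall>y\<in>T. \<forall>z\<in>T. qnorm (y - z) \<le> \<epsilon>" by simp
  ultimately show ?thesis
    unfolding diam_cover_def B_def by (intro exI[of _ "H ` F"] conjI)
qed

section \<open>Counting index sets and covering \<open>Sigma_poly\<close>\<close>

text \<open>Index sets are coded by lists of length exactly n with repetitions, so there are
  \<open>p ^ n\<close> of them.\<close>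

lemma Sigma_poly_subset:
  assumes "poly P (real n) < real p" "p \<ge> 1"
  shows "Sigma_poly smul g P n \<subseteq> (\<Union>xs\<in>{xs. set xs \<subseteq> {..<p} \<and> length xs = n}. span (g ` set xs))"
proof
  fix y assume "y \<in> Sigma_poly smul g P n"
  then obtain I where I: "I \<subseteq> {k. 1 \<le> k \<and> real k \<le> poly P (real n)}" "card I \<le> n" "y \<in> span (g ` I)"
    unfolding Sigma_poly_def by blast
  have I_sub: "I \<subseteq> {..<p}"
  proof
    fix k assume "k \<in> I"
    then have "real k < real p" using I(1) assms(1) by (force intro: le_less_trans)
    then show "k \<in> {..<p}" by simp
  qed
  then have fin: "finite I" by (rule finite_subset) simp
  \<comment> \<open>Padding with the index 0 can only enlarge the span; \<open>p \<ge> 1\<close>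
    keeps it in range.\<close>
  define xs where "xs = sorted_list_of_set I @ replicate (n - card I) 0"
  have "set xs \<subseteq> {..<p}" using I_sub fin assms(2) by (auto simp: xs_def)
  moreover have "length xs = n" using I(2) by (simp add: xs_def)
  moreover have "I \<subseteq> set xs" using fin by (simp add: xs_def)
  then have "y \<in> span (g ` set xs)" using I(3) span_mono[of "g ` I" "g ` set xs"] by blast
  ultimately show "y \<in> (\<Union>xs\<in>{xs. set xs \<subseteq> {..<p} \<and> length xs = n}. span (g ` set xs))" by blast
qed

text \<open>There are \<open>p ^ n\<close> index lists with \<open>N ^ n\<close> pieces each, where
  \<open>p\<close> and \<open>N\<close> are at most powers of two with exponents affine in
  \<open>L\<close>. With \<open>2 ^ L\<close> of the order of n this is exp(O(n ln n)).\<close>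

lemma diam_cover_Sigma_poly:
  assumes "R > 0" "\<alpha> > 0"
  obtains a b :: nat where
    "\<And>n L. n \<ge> 1 \<Longrightarrow> n \<le> 2 ^ L \<Longrightarrow>
      diam_cover qnorm (qcball qnorm x R \<inter> Sigma_poly smul g P n) (2 ^ (n * (a + b * L))) (real n powr - \<alpha>)"
proof -
  obtain C q where P: "\<And>n. n \<ge> 1 \<Longrightarrow> poly P (real n) < real (C * n ^ q)" and C: "C \<ge> 1"
    using poly_less_monomial[of P] by metis
  obtain N0 where N0: "\<And>(c :: 'k) r j. r > 0 \<Longrightarrow>
      \<exists>C. finite C \<and> card C \<le> N0 ^ j \<and> cball c r \<subseteq> (\<Union>y\<in>C. cball y (r / 2 ^ j))"
    using cball_halving_cover by metis
  have N0_le: "N0 \<le> 2 ^ N0" by (rule less_imp_le) (rule less_exp)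
  have C2: "C \<le> 2 ^ C" by (rule less_imp_le) (rule less_exp)
  define D where "D = 2 * (2 ^ \<kappa>)\<^sup>2 * (R + 1)"
  have D: "D > 0" using assms by (simp add: D_def)
  define r where "r = 2 * (2 ^ \<kappa> * (D + 1))"
  have r: "r > 0" using D by (simp add: r_def)
  \<comment> \<open>The part of \<open>r / (\<delta> / 2)\<close> that does not depend on n; the
    rest is \<open>n ^ Suc \<kappa>\<close> times \<open>n powr \<alpha>\<close>.\<close>
  define c where "c = r * 2 * (4 * (2 ^ \<kappa>)\<^sup>2 * 2 ^ Suc \<kappa>)"
  have c: "c > 0" using r by (simp add: c_def)
  obtain s :: nat where s: "c \<le> 2 ^ s" using real_arch_pow[of 2 c] by (auto intro: less_imp_le)
  define t where "t = nat \<lceil>\<alpha>\<rceil>"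
  have t: "\<alpha> \<le> real t" unfolding t_def by (rule real_nat_ceiling_ge)
  have "diam_cover qnorm (qcball qnorm x R \<inter> Sigma_poly smul g P n)
      (2 ^ (n * ((C + N0 * s) + (q + N0 * (Suc \<kappa> + t)) * L))) (real n powr - \<alpha>)"
    if n: "n \<ge> 1" "n \<le> 2 ^ L" for n L
  proof -
    define \<epsilon> where "\<epsilon> = real n powr - \<alpha>"
    have \<epsilon>: "0 < \<epsilon>" "\<epsilon> \<le> 1" using n assms powr_mono[of "- \<alpha>" 0 "real n"] by (auto simp: \<epsilon>_def)
    define \<delta> where "\<delta> = \<epsilon> / (4 * (2 ^ \<kappa>)\<^sup>2 * (2 * real n) ^ Suc \<kappa>)"
    \<comment> \<open>Enough halvings to get from \<open>r\<close> to \<open>\<delta> / 2\<close>: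
      \<open>s\<close> for the constant \<open>c\<close>, \<open>Suc \<kappa>\<close> times
      \<open>L\<close> for the summation loss and \<open>t\<close> times \<open>L\<close> for the
      radius.\<close>
    define j where "j = s + (Suc \<kappa> + t) * L"
    define N :: nat where "N = 2 ^ (N0 * j)"
    have nL: "real n \<le> 2 ^ L" using n(2) by (metis of_nat_le_iff of_nat_numeral of_nat_power)
    have rj: "r / 2 ^ j \<le> \<delta> / 2"
    proof -
      have "real n powr \<alpha> \<le> real n ^ t" using n t powr_mono[of \<alpha> "real t" "real n"] by (simp add: powr_realpow)
      then have "c * (real n ^ Suc \<kappa> * real n powr \<alpha>) \<le> 2 ^ s * ((2 ^ L) ^ Suc \<kappa> * (2 ^ L) ^ t)"
        using s c power_mono[OF nL, of t] power_mono[OF nL, of "Suc \<kappa>"]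
        by (intro mult_mono) (auto intro: order_trans)
      also have "\<dots> = 2 ^ j" by (simp add: j_def power_add algebra_simps flip: power_mult)
      finally have "c * (real n ^ Suc \<kappa> * real n powr \<alpha>) \<le> 2 ^ j" .
      moreover have "r / (\<delta> / 2) = c * (real n ^ Suc \<kappa> * real n powr \<alpha>)"
        using n by (simp add: \<delta>_def \<epsilon>_def c_def powr_minus power_mult_distrib field_simps)
      ultimately have "r / (\<delta> / 2) \<le> 2 ^ j" by simp
      moreover have "\<delta> > 0" using \<epsilon> n by (simp add: \<delta>_def)
      ultimately show ?thesis by (simp add: field_simps)
    qed
    have cover: "\<exists>C. finite C \<and> card C \<le> N \<and> cball z r \<subseteq> (\<Union>y\<in>C. cball y (\<delta> / 2))" for z :: 'k
    proof -
      obtain C where C: "finite C" "card C \<le> N0 ^ j" "cball z r \<subseteq> (\<Union>y\<in>C. cball y (r / 2 ^ j))"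
        using N0[OF r] by blast
      have "N0 ^ j \<le> N" using power_mono[OF N0_le, of j] by (simp add: N_def power_mult)
      moreover have "(\<Union>y\<in>C. cball y (r / 2 ^ j)) \<subseteq> (\<Union>y\<in>C. cball y (\<delta> / 2))"
        using subset_cball[OF rj] by blast
      ultimately show ?thesis using C by (meson order_trans)
    qed
    define p where "p = C * n ^ q"
    have p: "p \<ge> 1" "poly P (real n) < real p" using C n P by (auto simp: p_def)
    let ?J = "{xs. set xs \<subseteq> {..<p} \<and> length xs = n}"
    have cov: "diam_cover qnorm (\<Union>xs\<in>?J. qcball qnorm x R \<inter> span (g ` set xs)) (card ?J * N ^ n) \<epsilon>"
    proof (rule diam_cover_UN)
      show "finite ?J" by (rule finite_lists_length_eq) simp
      fix xs assume "xs \<in> ?J"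
      then have "card (g ` set xs) \<le> n"
        by (metis (mono_tags) List.finite_set card_image_le card_length le_trans mem_Collect_eq)
      moreover have "N \<ge> 1" by (simp add: N_def)
      ultimately show "diam_cover qnorm (qcball qnorm x R \<inter> span (g ` set xs)) (N ^ n) \<epsilon>"
        using n(1) assms(1) \<epsilon> \<delta>_def D_def cover by (intro diam_cover_span) (auto simp: r_def)
    qed
    have count: "card ?J * N ^ n \<le> 2 ^ (n * ((C + N0 * s) + (q + N0 * (Suc \<kappa> + t)) * L))"
    proof -
      have "p \<le> 2 ^ C * (2 ^ L) ^ q" unfolding p_def using C2 n(2) by (intro mult_mono power_mono) auto
      then have "card ?J * N ^ n \<le> (2 ^ C * (2 ^ L) ^ q) ^ n * N ^ n"
        by (simp add: card_lists_length_eq power_mono)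
      also have "\<dots> = (2 ^ (C + L * q + N0 * j)) ^ n"
        by (simp add: N_def power_add power_mult power_mult_distrib)
      also have "\<dots> = 2 ^ (n * ((C + N0 * s) + (q + N0 * (Suc \<kappa> + t)) * L))"
        by (simp add: j_def algebra_simps flip: power_mult)
      finally show ?thesis .
    qed
    have "qcball qnorm x R \<inter> Sigma_poly smul g P n
        \<subseteq> (\<Union>xs\<in>?J. qcball qnorm x R \<inter> span (g ` set xs))"
      unfolding Int_UN_distrib[symmetric] by (intro Int_mono order_refl Sigma_poly_subset p)
    then show ?thesis unfolding \<epsilon>_def[symmetric] by (rule diam_cover_mono[OF cov _ count])
  qed
  then show ?thesis by (rule that)
qed

end

section \<open>Controlled complexity\<close>

text \<open>Since ln n is at most n^\<delta> / \<delta>, the logarithm is absorbed by any positive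
  power.\<close>

lemma bdd_above_linearithmic:
  fixes a b \<delta> :: real
  assumes "a \<ge> 0" "b \<ge> 0" "\<delta> > 0"
  shows "bdd_above ((\<lambda>n. real n * (a + b * ln (real n)) / real n powr (1 + \<delta>)) ` {1..})"
proof (rule bdd_aboveI2[where M = "a + b / \<delta>"])
  fix n :: nat assume "n \<in> {1..}"
  then have n: "real n \<ge> 1" by simp
  then have "1 \<le> real n powr \<delta>" using assms(3) by (simp add: ge_one_powr_ge_zero)
  then have "a * 1 + b * ln (real n) \<le> a * real n powr \<delta> + b * (real n powr \<delta> / \<delta>)"
    using assms ln_powr_bound[OF n assms(3)] by (intro add_mono mult_left_mono) auto
  then have "(a + b * ln (real n)) / real n powr \<delta> \<le> a + b / \<delta>"
    using n assms(3) by (simp add: divide_le_eq algebra_simps)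
  moreover have "real n * (a + b * ln (real n)) / real n powr (1 + \<delta>) = (a + b * ln (real n)) / real n powr \<delta>"
    using n by (simp add: powr_add)
  ultimately show "real n * (a + b * ln (real n)) / real n powr (1 + \<delta>) \<le> a + b / \<delta>" by simp
qed

theorem proposition1p18:
  fixes smul :: "'k::{real_normed_field, euclidean_space} \<Rightarrow> 'v::ab_group_add \<Rightarrow> 'v"
    and qnorm :: "'v \<Rightarrow> real"
    and g :: "nat \<Rightarrow> 'v"
    and P :: "real poly"
  assumes "quasi_normed_space smul qnorm"
  shows "controlled_complexity qnorm (Sigma_poly smul g P)"
proof -
  interpret quasi_normed_space smul qnorm by (rule assms)
  obtain k where k: "k \<ge> 1" "\<And>x y. qnorm (x + y) \<le> k * (qnorm x + qnorm y)"
    using quasi_triangle by blast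
  obtain \<kappa> :: nat where \<kappa>: "k < 2 ^ \<kappa>" using real_arch_pow[of 2 k] by auto
  interpret quasi_normed_modulus smul qnorm \<kappa>
  proof
    fix x y
    have "k * (qnorm x + qnorm y) \<le> 2 ^ \<kappa> * (qnorm x + qnorm y)"
      using \<kappa> qnorm_nonneg[of x] qnorm_nonneg[of y] by (intro mult_right_mono) auto
    then show "qnorm (x + y) \<le> 2 ^ \<kappa> * (qnorm x + qnorm y)" using k(2)[of x y] by linarith
  qed
  have "Sigma_poly smul g P n \<noteq> {}" for n
  proof -
    have "0 \<in> Sigma_poly smul g P n" unfolding Sigma_poly_def by (auto intro!: exI[of _ "{}"])
    then show ?thesis by blast
  qed
  moreover have "\<exists>n\<^sub>0\<ge>1. \<exists>\<eta> :: nat \<Rightarrow> real. (\<forall>n\<ge>1. 0 \<le> \<eta> n) \<and>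
       (\<forall>\<delta>>0. bdd_above ((\<lambda>n. \<eta> n / real n powr (1 + \<delta>)) ` {1..})) \<and>
       (\<forall>n\<ge>n\<^sub>0. ereal_of_enat (covering_number qnorm (qcball qnorm x R \<inter> Sigma_poly smul g P n) (real n powr - \<alpha>))
                  \<le> ereal (exp (\<eta> n)))"
    if "\<alpha> > 0" "R > 0" for \<alpha> x R
  proof -
    obtain a b :: nat where ab: "\<And>n L. n \<ge> 1 \<Longrightarrow> n \<le> 2 ^ L \<Longrightarrow>
      diam_cover qnorm (qcball qnorm x R \<inter> Sigma_poly smul g P n) (2 ^ (n * (a + b * L))) (real n powr - \<alpha>)"
      using diam_cover_Sigma_poly[OF \<open>R > 0\<close> \<open>\<alpha> > 0\<close>, of x g P] by blast
    \<comment> \<open>The extra \<open>b\<close> pays for rounding log2 n up to the integer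
      \<open>L\<close>: \<open>L * ln 2\<close> is at most ln n + 1.\<close>
    define \<eta> where "\<eta> n = real n * (real (a + b) + real b * ln (real n))" for n
    have "ereal_of_enat (covering_number qnorm (qcball qnorm x R \<inter> Sigma_poly smul g P n) (real n powr - \<alpha>))
        \<le> ereal (exp (\<eta> n))" if n: "n \<ge> 1" for n
    proof -
      obtain l where l: "2 ^ l \<le> n" "n < 2 ^ (l + 1)" using ex_power_ivl1[of 2 n] n by auto
      define L where "L = l + 1"
      have "real (2 ^ l) \<le> real n" using l(1) by (simp only: of_nat_le_iff)
      then have "ln (2 ^ l) \<le> ln (real n)" using n by (intro ln_mono) auto
      then have ln_L: "real L * ln 2 \<le> ln (real n) + 1"
        using ln_2_less_1 by (simp add: L_def ln_realpow algebra_simps)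
      have "real (n * (a + b * L)) * ln 2 = real n * (real a * ln 2 + real b * (real L * ln 2))"
        by (simp add: algebra_simps)
      also have "\<dots> \<le> real n * (real a * 1 + real b * (ln (real n) + 1))"
        using ln_L ln_2_less_1 by (intro mult_left_mono add_mono) auto
      also have "\<dots> = \<eta> n" by (simp add: \<eta>_def algebra_simps)
      finally have "exp (real (n * (a + b * L)) * ln 2) \<le> exp (\<eta> n)" by simp
      then have "real (2 ^ (n * (a + b * L))) \<le> exp (\<eta> n)"
        by (simp only: exp_of_nat_mult exp_ln of_nat_power of_nat_numeral zero_less_numeral)
      moreover have "covering_number qnorm (qcball qnorm x R \<inter> Sigma_poly smul g P n) (real n powr - \<alpha>)
          \<le> enat (2 ^ (n * (a + b * L)))"
        using l(2) n by (intro covering_number_le ab) (auto simp: L_def)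
      then have "ereal_of_enat (covering_number qnorm (qcball qnorm x R \<inter> Sigma_poly smul g P n) (real n powr - \<alpha>))
          \<le> ereal (real (2 ^ (n * (a + b * L))))"
        by (metis ereal_of_enat_le_iff ereal_of_enat_simps(1))
      ultimately show ?thesis by (meson ereal_less_eq(3) order_trans)
    qed
    moreover have "\<forall>n\<ge>1. 0 \<le> \<eta> n" by (simp add: \<eta>_def)
    moreover have "\<forall>\<delta>>0. bdd_above ((\<lambda>n. \<eta> n / real n powr (1 + \<delta>)) ` {1..})"
      unfolding \<eta>_def by (intro allI impI bdd_above_linearithmic) auto
    \<comment> \<open>The bound holds for every n from 1 on, so the threshold is 1.\<close>
    ultimately show ?thesis by (intro exI[of _ 1] conjI exI[of _ \<eta>]) auto
  qed
  ultimately show ?thesis unfolding controlled_complexity_def by simp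
qed

end
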